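(* For any two vertex lattices $\Lambda,\Lambda'$ in $U$ there is a finite sequence of vertex lattices $\Lambda_0=\Lambda,\Lambda_1,\dots,\Lambda_n=\Lambda'$ such that for each $0\le i\le n-1$ either $\Lambda_i\subset\Lambda_{i+1}$ or $\Lambda_i\supset\Lambda_{i+1}$.
   Context: $p$ is an odd prime, $e\in\mathbb Z_p^\times$ a non-square. $(U,Q)$ is a $5$-dimensional quadratic space over $\mathbb Q_p$ possessing an orthogonal basis $u_1,\dots,u_5$ with $Q(u_1)=-ep$, $Q(u_2)=-1$, $Q(u_3)=e$, $Q(u_4)=-1$, $Q(u_5)=e$. Let $[v,w]=Q(v+w)-Q(v)-Q(w)$. For a $\mathbb Z_p$-lattice $\Lambda\subset U$, $\Lambda^\vee=\{v\in U:[v,\Lambda]\subset\mathbb Z_p\}$. A vertex lattice is a lattice $\Lambda$ with $p\Lambda\subset\Lambda^\vee\subset\Lambda$. *)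

theory Defs
  imports "HOL-Analysis.Analysis"
begin

section \<open>The p-adic field, axiomatically\<close>

text \<open>A field K with a Z-valued valuation v (defined on nonzero elements) is
  called here a p-adic field if v is multiplicative and ultrametric, v p = 1,
  K is complete w.r.t. v, and every integral element is congruent mod p to one
  of 0,...,p-1.  Together with characteristic 0 this characterises (K,v)
  up to isomorphism as (Q_p, v_p).\<close>

definition vclose :: "('k::field \<Rightarrow> int) \<Rightarrow> 'k \<Rightarrow> 'k \<Rightarrow> nat \<Rightarrow> bool" where
  "vclose v x y N \<longleftrightarrow> x = y \<or> int N \<le> v (x - y)"

definition is_padic_field :: "nat \<Rightarrow> ('k::field_char_0 \<Rightarrow> int) \<Rightarrow> bool" where
  "is_padic_field p v \<longleftrightarrow>
     (\<forall>x y. x \<noteq> 0 \<longrightarrow> y \<noteq> 0 \<longrightarrow> v (x * y) = v x + v y) \<and>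
     (\<forall>x y. x \<noteq> 0 \<longrightarrow> y \<noteq> 0 \<longrightarrow> x + y \<noteq> 0 \<longrightarrow> min (v x) (v y) \<le> v (x + y)) \<and>
     v (of_nat p) = 1 \<and>
     (\<forall>X :: nat \<Rightarrow> 'k.
        (\<forall>N. \<exists>M. \<forall>m\<ge>M. \<forall>n\<ge>M. vclose v (X m) (X n) N) \<longrightarrow>
        (\<exists>L. \<forall>N. \<exists>M. \<forall>n\<ge>M. vclose v (X n) L N)) \<and>
     (\<forall>x. x \<noteq> 0 \<longrightarrow> 0 \<le> v x \<longrightarrow> (\<exists>a<p. vclose v x (of_nat a) 1))"

text \<open>The valuation ring Z_p.\<close>
definition vring :: "('k::field \<Rightarrow> int) \<Rightarrow> 'k set" where
  "vring v = {x. x = 0 \<or> 0 \<le> v x}"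

section \<open>The quadratic space U = K^5 with orthogonal basis u_1,...,u_5\<close>

text \<open>Coordinates are taken w.r.t. the orthogonal basis u_1..u_5, indexed by
  the elements 0,1,2,3,4 of the numeral type 5 (index i stands for u_(i+1)).\<close>

definition qcoeff :: "nat \<Rightarrow> 'k::field \<Rightarrow> 5 \<Rightarrow> 'k" where
  "qcoeff p e i =
     (if i = 0 then - (e * of_nat p) else if i = 1 then -1 else if i = 2 then e
      else if i = 3 then -1 else e)"

definition Qform :: "nat \<Rightarrow> 'k::field \<Rightarrow> 'k ^ 5 \<Rightarrow> 'k" where
  "Qform p e x = (\<Sum>i\<in>UNIV. qcoeff p e i * (x $ i) ^ 2)"

definition bil :: "nat \<Rightarrow> 'k::field \<Rightarrow> 'k ^ 5 \<Rightarrow> 'k ^ 5 \<Rightarrow> 'k" where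
  "bil p e x y = Qform p e (x + y) - Qform p e x - Qform p e y"

section \<open>Lattices and vertex lattices\<close>

text \<open>A Z_p-lattice in U: the Z_p-span of a K-basis of U.\<close>
definition is_lattice :: "('k::field \<Rightarrow> int) \<Rightarrow> ('k ^ 5) set \<Rightarrow> bool" where
  "is_lattice v L \<longleftrightarrow>
     (\<exists>b :: 5 \<Rightarrow> 'k ^ 5.
        (\<forall>a. (\<Sum>i\<in>UNIV. a i *s b i) = 0 \<longrightarrow> (\<forall>i. a i = 0)) \<and>
        L = {(\<Sum>i\<in>UNIV. a i *s b i) | a. \<forall>i. a i \<in> vring v})"

definition dual_lattice :: "nat \<Rightarrow> 'k::field \<Rightarrow> ('k \<Rightarrow> int) \<Rightarrow> ('k ^ 5) set \<Rightarrow> ('k ^ 5) set" where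
  "dual_lattice p e v L = {x. \<forall>y\<in>L. bil p e x y \<in> vring v}"

definition is_vertex_lattice :: "nat \<Rightarrow> 'k::field \<Rightarrow> ('k \<Rightarrow> int) \<Rightarrow> ('k ^ 5) set \<Rightarrow> bool" where
  "is_vertex_lattice p e v L \<longleftrightarrow>
     is_lattice v L \<and>
     (\<lambda>x. of_nat p *s x) ` L \<subseteq> dual_lattice p e v L \<and>
     dual_lattice p e v L \<subseteq> L"

end

theory Submission
  imports Defs
begin

text \<open>Write N^\<or> for the dual lattice. Given vertex lattices L and L', the lattice
  N = (L + L')^\<or> is integral (N \<subseteq> N^\<or>) and L, L' \<subseteq> N^\<or>. Induct on the least k with
  p^k N^\<or> \<subseteq> N. If k \<le> 1, then N^\<or> is itself a vertex lattice containing L and L'.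
  Otherwise N' = N + p^(k-1) N^\<or> is again integral with p^(k-1) N'^\<or> \<subseteq> N', and every
  vertex lattice A \<subseteq> N^\<or> is joined to the vertex lattice ((A + N')^\<or> + N')^\<or> \<subseteq> N'^\<or>
  through A \<subseteq> A + N'.\<close>

section \<open>Independent families of vectors\<close>

definition independent_family :: "'i set \<Rightarrow> ('i \<Rightarrow> 'k::field ^ 'n) \<Rightarrow> bool" where
  "independent_family S b \<longleftrightarrow> (\<forall>a. (\<Sum>i\<in>S. a i *s b i) = 0 \<longrightarrow> (\<forall>i\<in>S. a i = 0))"

lemma independent_family_spans:
  fixes b :: "'n::finite \<Rightarrow> 'k::field ^ 'n"
  assumes "independent_family UNIV b"
  shows "\<exists>a. x = (\<Sum>i\<in>UNIV. a i *s b i)"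
proof -
  have ind: "(\<Sum>i\<in>UNIV. a i *s b i) = 0 \<Longrightarrow> a i = 0" for a i
    using assms unfolding independent_family_def by blast
  have inj: "inj b"
  proof (rule injI, rule ccontr)
    fix i j assume eq: "b i = b j" and ne: "i \<noteq> j"
    define a where "a = (\<lambda>l. if l = i then (1::'k) else if l = j then -1 else 0)"
    have "(\<Sum>l\<in>UNIV. a l *s b l) = (\<Sum>l\<in>{i,j}. a l *s b l)"
      by (rule sum.mono_neutral_right) (auto simp: a_def)
    also have "\<dots> = 0" using eq ne by (simp add: a_def)
    finally have "a i = 0" by (rule ind)
    then show False by (simp add: a_def)
  qed
  have indep: "vec.independent (range b)"
  proof
    assume "vec.dependent (range b)"
    then obtain u where u: "\<exists>w\<in>range b. u w \<noteq> 0" "(\<Sum>w\<in>range b. u w *s w) = 0"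
      using vec.dependent_finite[of "range b"] by auto
    have "(\<Sum>i\<in>UNIV. u (b i) *s b i) = 0"
      using u(2) by (simp add: sum.reindex[OF inj])
    with u(1) ind[of "\<lambda>i. u (b i)"] show False by auto
  qed
  have "card (range b) = vec.dim (UNIV :: ('k^'n) set)"
    by (simp add: card_image[OF inj] card_cart_basis)
  then have "x \<in> vec.span (range b)"
    using vec.card_eq_dim[of "range b" UNIV] indep by auto
  then obtain u where "x = (\<Sum>w\<in>range b. u w *s w)"
    using vec.span_finite[of "range b"] by auto
  then show ?thesis by (auto simp: sum.reindex[OF inj])
qed

lemma sum_scale_insert_fun_upd:
  assumes "finite S" "j \<notin> S"
  shows "(\<Sum>i\<in>insert j S. a i *s (b(j := y)) i) = a j *s y + (\<Sum>i\<in>S. a i *s b i)"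
proof -
  have "(\<Sum>i\<in>S. a i *s (b(j := y)) i) = (\<Sum>i\<in>S. a i *s b i)"
    using assms(2) by (intro sum.cong) auto
  then show ?thesis using assms by simp
qed

lemma independent_family_insert:
  assumes "finite S" "j \<notin> S" "independent_family S b" "\<forall>i\<in>S. b i $ j = 0" "y $ j \<noteq> 0"
  shows "independent_family (insert j S) (b(j := y))"
  unfolding independent_family_def
proof (intro allI impI)
  fix a assume "(\<Sum>i\<in>insert j S. a i *s (b(j := y)) i) = 0"
  then have sum0: "a j *s y + (\<Sum>i\<in>S. a i *s b i) = 0"
    by (simp only: sum_scale_insert_fun_upd[OF assms(1,2)])
  have "(\<Sum>i\<in>S. a i *s b i) $ j = 0"
    using assms(4) by (simp add: sum_component)
  then have "a j * y $ j = 0"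
    using arg_cong[OF sum0, of "\<lambda>x. x $ j"] by simp
  then have "a j = 0" using assms(5) by simp
  moreover have "\<forall>i\<in>S. a i = 0"
    using sum0 \<open>a j = 0\<close> assms(3) unfolding independent_family_def by simp
  ultimately show "\<forall>i\<in>insert j S. a i = 0" by simp
qed

lemma independent_family_scale:
  assumes "independent_family S b" "c \<noteq> 0"
  shows "independent_family S (\<lambda>i. c *s b i)"
  unfolding independent_family_def
proof (intro allI impI)
  fix a assume "(\<Sum>i\<in>S. a i *s (c *s b i)) = 0"
  then have "(\<Sum>i\<in>S. (c * a i) *s b i) = 0"
    by (simp add: vector_smult_assoc mult.commute)
  then have "\<forall>i\<in>S. c * a i = 0"
    using assms(1)[unfolded independent_family_def, rule_format, of "\<lambda>i. c * a i"] by simp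
  then show "\<forall>i\<in>S. a i = 0" using assms(2) by simp
qed

section \<open>The bilinear form\<close>

lemma bil_expand: "bil p e x y = (\<Sum>i\<in>UNIV. 2 * qcoeff p e i * x $ i * y $ i)"
proof -
  have "bil p e x y = (\<Sum>i\<in>UNIV. qcoeff p e i * ((x + y) $ i)\<^sup>2 - qcoeff p e i * (x $ i)\<^sup>2
      - qcoeff p e i * (y $ i)\<^sup>2)"
    unfolding bil_def Qform_def by (simp add: sum_subtractf)
  also have "\<dots> = (\<Sum>i\<in>UNIV. 2 * qcoeff p e i * x $ i * y $ i)"
    by (rule sum.cong) (auto simp: power2_eq_square algebra_simps)
  finally show ?thesis .
qed

lemma bil_commute: "bil p e x y = bil p e y x"
  unfolding bil_expand by (simp add: mult_ac)

lemma bil_add_left: "bil p e (x + y) z = bil p e x z + bil p e y z"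
  unfolding bil_expand by (simp add: algebra_simps sum.distrib)

lemma bil_add_right: "bil p e z (x + y) = bil p e z x + bil p e z y"
  unfolding bil_expand by (simp add: algebra_simps sum.distrib)

lemma bil_scale_left: "bil p e (c *s x) y = c * bil p e x y"
  unfolding bil_expand by (simp add: sum_distrib_left mult_ac)

lemma bil_scale_right: "bil p e y (c *s x) = c * bil p e y x"
  unfolding bil_expand by (simp add: sum_distrib_left mult_ac)

lemma bil_zero_left [simp]: "bil p e 0 x = 0"
  unfolding bil_expand by simp

lemma bil_sum_left: "bil p e (\<Sum>i\<in>S. a i *s b i) x = (\<Sum>i\<in>S. a i * bil p e (b i) x)"
  by (induction S rule: infinite_finite_induct) (simp_all add: bil_add_left bil_scale_left)

lemma bil_sum_right: "bil p e x (\<Sum>i\<in>S. a i *s b i) = (\<Sum>i\<in>S. a i * bil p e x (b i))"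
  by (simp add: bil_commute[of p e x] bil_sum_left)

lemma bil_axis:
  fixes x :: "'k::field ^ 5"
  shows "bil p e x (axis l 1) = 2 * qcoeff p e l * x $ l"
proof -
  have "bil p e x (axis l 1) = (\<Sum>i\<in>{l}. 2 * qcoeff p e i * x $ i * (axis l 1 :: 'k ^ 5) $ i)"
    unfolding bil_expand by (rule sum.mono_neutral_right) (auto simp: axis_def)
  then show ?thesis by (simp add: axis_def)
qed

lemma bil_nondegenerate:
  fixes x y :: "'k::field_char_0 ^ 5"
  assumes "e \<noteq> 0" "p \<noteq> 0" "\<And>w. bil p e x w = bil p e y w"
  shows "x = y"
proof -
  have "qcoeff p e l \<noteq> 0" for l
    using assms(1,2) unfolding qcoeff_def by auto
  then show ?thesis
    using assms(3)[of "axis _ 1"] by (simp add: bil_axis vec_eq_iff)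
qed

lemma dual_lattice_antimono: "A \<subseteq> B \<Longrightarrow> dual_lattice p e v B \<subseteq> dual_lattice p e v A"
  unfolding dual_lattice_def by auto

lemma subset_dual_lattice_iff:
  "A \<subseteq> dual_lattice p e v B \<longleftrightarrow> (\<forall>x\<in>A. \<forall>y\<in>B. bil p e x y \<in> vring v)"
  unfolding dual_lattice_def by blast

lemma subset_dual_lattice_swap: "A \<subseteq> dual_lattice p e v B \<longleftrightarrow> B \<subseteq> dual_lattice p e v A"
  unfolding subset_dual_lattice_iff by (metis bil_commute)

section \<open>Lattices over a discretely valued field\<close>

locale discretely_valued_field =
  fixes v :: "'k::field \<Rightarrow> int" and \<pi> :: 'k
  assumes v_mult: "x \<noteq> 0 \<Longrightarrow> y \<noteq> 0 \<Longrightarrow> v (x * y) = v x + v y"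
    and v_add: "x \<noteq> 0 \<Longrightarrow> y \<noteq> 0 \<Longrightarrow> x + y \<noteq> 0 \<Longrightarrow> min (v x) (v y) \<le> v (x + y)"
    and uniformizer_nonzero: "\<pi> \<noteq> 0"
    and v_uniformizer: "v \<pi> = 1"
begin

lemma v_one: "v 1 = 0"
  using v_mult[of 1 1] by simp

lemma v_inverse: "x \<noteq> 0 \<Longrightarrow> v (inverse x) = - v x"
  using v_mult[of x "inverse x"] v_one by simp

lemma v_uminus: "x \<noteq> 0 \<Longrightarrow> v (- x) = v x"
  using v_mult[of "-1" "-1"] v_mult[of "-1" x] v_one by simp

lemma v_power_uniformizer: "v (\<pi> ^ n) = int n"
  by (induction n) (simp_all add: v_one v_mult uniformizer_nonzero v_uniformizer)

lemma vring_zero [simp]: "0 \<in> vring v"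
  by (simp add: vring_def)

lemma vring_one [simp]: "1 \<in> vring v"
  by (simp add: vring_def v_one)

lemma vring_add [intro]: "x \<in> vring v \<Longrightarrow> y \<in> vring v \<Longrightarrow> x + y \<in> vring v"
  unfolding vring_def using v_add[of x y] by fastforce

lemma vring_mult [intro]: "x \<in> vring v \<Longrightarrow> y \<in> vring v \<Longrightarrow> x * y \<in> vring v"
  unfolding vring_def using v_mult[of x y] by fastforce

lemma vring_uminus [intro]: "x \<in> vring v \<Longrightarrow> - x \<in> vring v"
  unfolding vring_def using v_uminus[of x] by fastforce

lemma vring_sum [intro]: "(\<And>i. i \<in> S \<Longrightarrow> f i \<in> vring v) \<Longrightarrow> sum f S \<in> vring v"
  by (induction S rule: infinite_finite_induct) auto

lemma vring_power_uniformizer [intro, simp]: "\<pi> ^ n \<in> vring v"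
  by (simp add: vring_def v_power_uniformizer)

lemma vring_uniformizer [intro, simp]: "\<pi> \<in> vring v"
  using vring_power_uniformizer[of 1] by simp

lemma divide_in_vring: "a \<noteq> 0 \<Longrightarrow> v a \<le> v b \<Longrightarrow> b / a \<in> vring v"
  unfolding vring_def divide_inverse by (cases "b = 0") (auto simp: v_mult v_inverse)

lemma eventually_power_mult_in_vring: "eventually (\<lambda>m. \<pi> ^ m * x \<in> vring v) sequentially"
proof (cases "x = 0")
  case False
  have "\<pi> ^ m * x \<in> vring v" if "nat (- v x) \<le> m" for m
    using that False uniformizer_nonzero by (simp add: vring_def v_mult v_power_uniformizer)
  then show ?thesis by (auto simp: eventually_sequentially)
qed simp

definition integral_vectors_on :: "'i set \<Rightarrow> ('k ^ 'i) set" where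
  "integral_vectors_on S = {x. (\<forall>i. x $ i \<in> vring v) \<and> (\<forall>i. i \<notin> S \<longrightarrow> x $ i = 0)}"

definition vring_submodule :: "('k ^ 'n) set \<Rightarrow> bool" where
  "vring_submodule Y \<longleftrightarrow>
     0 \<in> Y \<and> (\<forall>x\<in>Y. \<forall>y\<in>Y. x + y \<in> Y) \<and> (\<forall>c\<in>vring v. \<forall>x\<in>Y. c *s x \<in> Y)"

definition vring_span :: "'i set \<Rightarrow> ('i \<Rightarrow> 'k ^ 'n) \<Rightarrow> ('k ^ 'n) set" where
  "vring_span S b = {(\<Sum>i\<in>S. a i *s b i) | a. \<forall>i\<in>S. a i \<in> vring v}"

lemma vring_submodule_zero: "vring_submodule Y \<Longrightarrow> 0 \<in> Y"
  by (simp add: vring_submodule_def)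

lemma vring_submodule_add: "vring_submodule Y \<Longrightarrow> x \<in> Y \<Longrightarrow> y \<in> Y \<Longrightarrow> x + y \<in> Y"
  by (simp add: vring_submodule_def)

lemma vring_submodule_scale: "vring_submodule Y \<Longrightarrow> c \<in> vring v \<Longrightarrow> x \<in> Y \<Longrightarrow> c *s x \<in> Y"
  by (simp add: vring_submodule_def)

lemma vring_submodule_diff:
  assumes "vring_submodule Y" "x \<in> Y" "y \<in> Y"
  shows "x - y \<in> Y"
proof -
  have "(-1) *s y \<in> Y"
    using assms vring_submodule_scale vring_uminus[OF vring_one] by blast
  then show ?thesis
    using assms vring_submodule_add[of Y x "(-1) *s y"] by simp
qed

lemma vring_submodule_sum:
  "vring_submodule Y \<Longrightarrow> (\<And>i. i \<in> S \<Longrightarrow> c i \<in> vring v) \<Longrightarrow> (\<And>i. i \<in> S \<Longrightarrow> b i \<in> Y) \<Longrightarrow>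
    (\<Sum>i\<in>S. c i *s b i) \<in> Y"
  by (induction S rule: infinite_finite_induct)
    (auto simp: vring_submodule_zero vring_submodule_add vring_submodule_scale)

lemma vring_submodule_integral_vectors: "vring_submodule (integral_vectors_on S)"
  unfolding vring_submodule_def integral_vectors_on_def by auto

lemma vring_submodule_vring_span: "vring_submodule (vring_span S b)"
  unfolding vring_submodule_def vring_span_def
proof (intro conjI ballI)
  show "0 \<in> {\<Sum>i\<in>S. a i *s b i |a. \<forall>i\<in>S. a i \<in> vring v}"
    by (intro CollectI exI[of _ "\<lambda>i. 0"]) simp
next
  fix x y assume "x \<in> {\<Sum>i\<in>S. a i *s b i |a. \<forall>i\<in>S. a i \<in> vring v}"
    "y \<in> {\<Sum>i\<in>S. a i *s b i |a. \<forall>i\<in>S. a i \<in> vring v}"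
  then obtain a a' where "x = (\<Sum>i\<in>S. a i *s b i)" "\<forall>i\<in>S. a i \<in> vring v"
    "y = (\<Sum>i\<in>S. a' i *s b i)" "\<forall>i\<in>S. a' i \<in> vring v" by blast
  then show "x + y \<in> {\<Sum>i\<in>S. a i *s b i |a. \<forall>i\<in>S. a i \<in> vring v}"
    by (intro CollectI exI[of _ "\<lambda>i. a i + a' i"]) (auto simp: vector_sadd_rdistrib sum.distrib)
next
  fix c x assume c: "c \<in> vring v" and "x \<in> {\<Sum>i\<in>S. a i *s b i |a. \<forall>i\<in>S. a i \<in> vring v}"
  then obtain a where "x = (\<Sum>i\<in>S. a i *s b i)" "\<forall>i\<in>S. a i \<in> vring v" by blast
  then show "c *s x \<in> {\<Sum>i\<in>S. a i *s b i |a. \<forall>i\<in>S. a i \<in> vring v}"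
    using c by (intro CollectI exI[of _ "\<lambda>i. c * a i"])
      (auto simp: vec.scale_sum_right vector_smult_assoc)
qed

lemma basis_in_vring_span:
  assumes "finite S" "i \<in> S"
  shows "b i \<in> vring_span S b"
proof -
  have "(\<Sum>l\<in>S. (if l = i then 1 else 0) *s b l) = (\<Sum>l\<in>S. if l = i then b l else 0)"
    by (rule sum.cong) auto
  also have "\<dots> = b i"
    using assms by (simp add: sum.delta')
  finally show ?thesis
    unfolding vring_span_def by (intro CollectI exI[of _ "\<lambda>l. if l = i then 1 else 0"]) auto
qed

lemma vring_span_insert:
  assumes "finite S" "j \<notin> S"
  shows "vring_span (insert j S) (b(j := y)) =
    {c *s y + z | c z. c \<in> vring v \<and> z \<in> vring_span S b}"
proof (intro set_eqI iffI)
  fix x assume "x \<in> vring_span (insert j S) (b(j := y))"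
  then obtain a where "x = (\<Sum>i\<in>insert j S. a i *s (b(j := y)) i)" "\<forall>i\<in>insert j S. a i \<in> vring v"
    unfolding vring_span_def by blast
  then show "x \<in> {c *s y + z | c z. c \<in> vring v \<and> z \<in> vring_span S b}"
    unfolding vring_span_def sum_scale_insert_fun_upd[OF assms] by blast
next
  fix x assume "x \<in> {c *s y + z | c z. c \<in> vring v \<and> z \<in> vring_span S b}"
  then obtain c a where "x = c *s y + (\<Sum>i\<in>S. a i *s b i)" "c \<in> vring v" "\<forall>i\<in>S. a i \<in> vring v"
    unfolding vring_span_def by blast
  moreover have "(\<Sum>i\<in>S. (a(j := c)) i *s b i) = (\<Sum>i\<in>S. a i *s b i)"
    using assms(2) by (intro sum.cong) auto
  ultimately have "x = (\<Sum>i\<in>insert j S. (a(j := c)) i *s (b(j := y)) i)"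
    "\<forall>i\<in>insert j S. (a(j := c)) i \<in> vring v"
    unfolding sum_scale_insert_fun_upd[OF assms] by auto
  then show "x \<in> vring_span (insert j S) (b(j := y))"
    unfolding vring_span_def by blast
qed

text \<open>The generator is a vector of minimal valuation in the j-th coordinate.\<close>
lemma exists_coordinate_generator:
  assumes "Y \<subseteq> integral_vectors_on S" "y1 \<in> Y" "y1 $ j \<noteq> 0"
  obtains y0 where "y0 \<in> Y" "y0 $ j \<noteq> 0" "\<And>y. y \<in> Y \<Longrightarrow> y $ j / y0 $ j \<in> vring v"
proof -
  define W where "W = {n::nat. \<exists>y\<in>Y. y $ j \<noteq> 0 \<and> v (y $ j) = int n}"
  have v_nonneg: "0 \<le> v (y $ j)" if "y \<in> Y" "y $ j \<noteq> 0" for y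
    using that assms(1) unfolding integral_vectors_on_def vring_def by auto
  have "nat (v (y1 $ j)) \<in> W"
    using assms(2,3) v_nonneg unfolding W_def by force
  then have "(LEAST n. n \<in> W) \<in> W" by (rule LeastI)
  then obtain y0 where y0: "y0 \<in> Y" "y0 $ j \<noteq> 0" "v (y0 $ j) = int (LEAST n. n \<in> W)"
    unfolding W_def by blast
  have "y $ j / y0 $ j \<in> vring v" if y: "y \<in> Y" for y
  proof (cases "y $ j = 0")
    case False
    then have "nat (v (y $ j)) \<in> W"
      using y v_nonneg unfolding W_def by force
    then have "(LEAST n. n \<in> W) \<le> nat (v (y $ j))" by (rule Least_le)
    then show ?thesis
      using y0 v_nonneg[OF y False] by (intro divide_in_vring) auto
  qed simp
  with y0 that show ?thesis by blast
qed

lemma vring_submodule_has_basis: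
  fixes S :: "'n::finite set"
  assumes "finite S" "vring_submodule Y" "Y \<subseteq> integral_vectors_on S"
    "(*s) (\<pi> ^ k) ` integral_vectors_on S \<subseteq> Y"
  shows "\<exists>b. independent_family S b \<and> Y = vring_span S b"
  using assms
proof (induction S arbitrary: Y rule: finite_induct)
  case empty
  have "integral_vectors_on {} = {0 :: 'k ^ 'n}"
    by (auto simp: integral_vectors_on_def vec_eq_iff)
  then have "Y = {0}"
    using empty.prems vring_submodule_zero by blast
  then show ?case
    by (auto simp: independent_family_def vring_span_def)
next
  case (insert j S)
  define Z where "Z = {y \<in> Y. y $ j = 0}"
  have "vring_submodule Z"
    using insert.prems(1) unfolding Z_def vring_submodule_def by auto
  moreover have "Z \<subseteq> integral_vectors_on S"
    using insert.prems(2) unfolding Z_def integral_vectors_on_def by auto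
  moreover have "(*s) (\<pi> ^ k) ` integral_vectors_on S \<subseteq> Z"
    using insert.prems(3) insert.hyps(2) unfolding Z_def integral_vectors_on_def by auto
  ultimately obtain b where b: "independent_family S b" "Z = vring_span S b"
    using insert.IH by blast
  have "axis j 1 \<in> integral_vectors_on (insert j S)"
    by (auto simp: integral_vectors_on_def axis_def)
  then have "\<pi> ^ k *s axis j 1 \<in> Y"
    using insert.prems(3) by blast
  moreover have "(\<pi> ^ k *s axis j (1::'k)) $ j \<noteq> 0"
    using uniformizer_nonzero by simp
  ultimately obtain y0 where y0: "y0 \<in> Y" "y0 $ j \<noteq> 0" "\<And>y. y \<in> Y \<Longrightarrow> y $ j / y0 $ j \<in> vring v"
    using exists_coordinate_generator[OF insert.prems(2)] by blast
  have bZ: "b i \<in> Z" if "i \<in> S" for i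
    using basis_in_vring_span[OF insert.hyps(1) that] b(2) by simp
  have "Y = {c *s y0 + z | c z. c \<in> vring v \<and> z \<in> Z}"
  proof (intro set_eqI iffI)
    fix y assume y: "y \<in> Y"
    define c where "c = y $ j / y0 $ j"
    have "c *s y0 \<in> Y"
      using y0 y insert.prems(1) vring_submodule_scale unfolding c_def by blast
    then have "y - c *s y0 \<in> Z"
      using y y0(2) insert.prems(1) vring_submodule_diff unfolding Z_def c_def by auto
    moreover have "y = c *s y0 + (y - c *s y0)" by simp
    ultimately show "y \<in> {c *s y0 + z | c z. c \<in> vring v \<and> z \<in> Z}"
      using y0(3)[OF y] unfolding c_def by blast
  qed (use insert.prems(1) y0(1) in \<open>auto simp: Z_def intro: vring_submodule_add vring_submodule_scale\<close>)
  then have "Y = vring_span (insert j S) (b(j := y0))"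
    unfolding vring_span_insert[OF insert.hyps] b(2) .
  moreover have "independent_family (insert j S) (b(j := y0))"
    using independent_family_insert[OF insert.hyps b(1) _ y0(2)] bZ unfolding Z_def by blast
  ultimately show ?case by blast
qed

lemma vring_span_scale: "vring_span S (\<lambda>i. c *s b i) = (*s) c ` vring_span S b"
proof -
  have eq: "(\<Sum>i\<in>S. a i *s (c *s b i)) = c *s (\<Sum>i\<in>S. a i *s b i)" for a
    by (simp add: vec.scale_sum_right vector_smult_assoc mult.commute)
  show ?thesis
  proof (intro set_eqI iffI)
    fix x assume "x \<in> vring_span S (\<lambda>i. c *s b i)"
    then obtain a where "x = c *s (\<Sum>i\<in>S. a i *s b i)" "\<forall>i\<in>S. a i \<in> vring v"
      unfolding vring_span_def eq by blast
    then show "x \<in> (*s) c ` vring_span S b"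
      unfolding vring_span_def by blast
  next
    fix x assume "x \<in> (*s) c ` vring_span S b"
    then obtain a where "x = c *s (\<Sum>i\<in>S. a i *s b i)" "\<forall>i\<in>S. a i \<in> vring v"
      unfolding vring_span_def by blast
    then show "x \<in> vring_span S (\<lambda>i. c *s b i)"
      unfolding vring_span_def eq[symmetric] by blast
  qed
qed

lemma vring_submodule_scale_image:
  assumes "vring_submodule Y"
  shows "vring_submodule ((*s) c ` Y)"
  unfolding vring_submodule_def
proof (intro conjI ballI)
  show "0 \<in> (*s) c ` Y"
    using vring_submodule_zero[OF assms] by (rule image_eqI[rotated]) simp
next
  fix x y assume "x \<in> (*s) c ` Y" "y \<in> (*s) c ` Y"
  then obtain x' y' where "x' \<in> Y" "y' \<in> Y" "x = c *s x'" "y = c *s y'" by blast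
  then show "x + y \<in> (*s) c ` Y"
    using vring_submodule_add[OF assms]
    by (intro image_eqI[of _ _ "x' + y'"]) (simp_all add: vector_add_ldistrib)
next
  fix d x assume d: "d \<in> vring v" and "x \<in> (*s) c ` Y"
  then obtain x' where "x' \<in> Y" "x = c *s x'" by blast
  then show "d *s x \<in> (*s) c ` Y"
    using vring_submodule_scale[OF assms d]
    by (intro image_eqI[of _ _ "d *s x'"]) (simp_all add: vector_smult_assoc mult.commute)
qed

lemma vring_submodule_plus:
  assumes "vring_submodule A" "vring_submodule B"
  shows "vring_submodule (A + B)"
  unfolding vring_submodule_def
proof (intro conjI ballI)
  show "0 \<in> A + B"
    using set_plus_intro[OF vring_submodule_zero[OF assms(1)] vring_submodule_zero[OF assms(2)]]
    by simp
next
  fix x y assume "x \<in> A + B" "y \<in> A + B"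
  then obtain a b a' b' where "a \<in> A" "b \<in> B" "a' \<in> A" "b' \<in> B" "x = a + b" "y = a' + b'"
    by (meson set_plus_elim)
  moreover have "x + y = (a + a') + (b + b')"
    using calculation by (simp add: algebra_simps)
  ultimately show "x + y \<in> A + B"
    using vring_submodule_add[OF assms(1)] vring_submodule_add[OF assms(2)] set_plus_intro
    by metis
next
  fix c x assume c: "c \<in> vring v" and "x \<in> A + B"
  then obtain a b where "a \<in> A" "b \<in> B" "x = a + b"
    by (meson set_plus_elim)
  then show "c *s x \<in> A + B"
    using vring_submodule_scale[OF assms(1) c] vring_submodule_scale[OF assms(2) c] set_plus_intro
    by (metis vector_add_ldistrib)
qed

lemma eventually_scale_integral:
  "eventually (\<lambda>m. \<pi> ^ m *s x \<in> integral_vectors_on (UNIV :: 'n::finite set)) sequentially"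
proof -
  have "eventually (\<lambda>m. \<forall>i. \<pi> ^ m * x $ i \<in> vring v) sequentially"
    using eventually_power_mult_in_vring by (intro eventually_all_finite) auto
  then show ?thesis
    by (simp add: integral_vectors_on_def)
qed

definition sandwiched :: "('k ^ 'n) set \<Rightarrow> nat \<Rightarrow> bool" where
  "sandwiched Y k \<longleftrightarrow>
     (*s) (\<pi> ^ k) ` Y \<subseteq> integral_vectors_on UNIV \<and> (*s) (\<pi> ^ k) ` integral_vectors_on UNIV \<subseteq> Y"

lemma scale_power_add: "\<pi> ^ (m + k) *s x = \<pi> ^ m *s (\<pi> ^ k *s x)"
  by (simp add: vector_smult_assoc power_add)

lemma sandwiched_mono:
  assumes "vring_submodule Y" "sandwiched Y k" "k \<le> k'"
  shows "sandwiched Y k'"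
proof -
  have split: "\<pi> ^ k' *s x = \<pi> ^ (k' - k) *s (\<pi> ^ k *s x)" for x :: "'k ^ 'n"
    using scale_power_add[of "k' - k" k] assms(3) by simp
  have "\<pi> ^ k' *s x \<in> integral_vectors_on UNIV" if "x \<in> Y" for x
    using that assms(2) vring_submodule_scale[OF vring_submodule_integral_vectors vring_power_uniformizer]
    unfolding sandwiched_def split by blast
  moreover have "\<pi> ^ k' *s x \<in> Y" if "x \<in> integral_vectors_on UNIV" for x
    using that assms(2) vring_submodule_scale[OF assms(1) vring_power_uniformizer]
    unfolding sandwiched_def split by blast
  ultimately show ?thesis
    unfolding sandwiched_def by blast
qed

lemma sandwiched_vring_span:
  fixes b :: "'n::finite \<Rightarrow> 'k ^ 'n"
  assumes "independent_family UNIV b"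
  shows "\<exists>k. sandwiched (vring_span UNIV b) k"
proof -
  have "\<forall>l. \<exists>a. axis l 1 = (\<Sum>i\<in>UNIV. a i *s b i)"
    using independent_family_spans[OF assms] by blast
  then obtain d where d: "\<And>l. axis l 1 = (\<Sum>i\<in>UNIV. d l i *s b i)"
    by metis
  have "eventually (\<lambda>m. \<forall>i. \<pi> ^ m *s b i \<in> integral_vectors_on UNIV) sequentially"
    using eventually_scale_integral by (intro eventually_all_finite) auto
  moreover have "eventually (\<lambda>m. \<forall>l i. \<pi> ^ m * d l i \<in> vring v) sequentially"
    using eventually_power_mult_in_vring by (intro eventually_all_finite) auto
  ultimately have "eventually (\<lambda>m. (\<forall>i. \<pi> ^ m *s b i \<in> integral_vectors_on UNIV) \<and>
      (\<forall>l i. \<pi> ^ m * d l i \<in> vring v)) sequentially"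
    by (rule eventually_conj)
  then obtain k where bk: "\<And>i. \<pi> ^ k *s b i \<in> integral_vectors_on UNIV"
    and dk: "\<And>l i. \<pi> ^ k * d l i \<in> vring v"
    unfolding eventually_sequentially by blast
  have scale_sum: "c *s (\<Sum>i\<in>UNIV. a i *s w i) = (\<Sum>i\<in>UNIV. a i *s (c *s w i))"
    for c a and w :: "'n \<Rightarrow> 'k ^ 'n"
    by (simp add: vec.scale_sum_right vector_smult_assoc mult.commute)
  have "\<pi> ^ k *s x \<in> integral_vectors_on UNIV" if x: "x \<in> vring_span UNIV b" for x
  proof -
    obtain a where a: "x = (\<Sum>i\<in>UNIV. a i *s b i)" "\<forall>i. a i \<in> vring v"
      using x unfolding vring_span_def by blast
    have "(\<Sum>i\<in>UNIV. a i *s (\<pi> ^ k *s b i)) \<in> integral_vectors_on UNIV"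
      using a(2) bk by (intro vring_submodule_sum[OF vring_submodule_integral_vectors]) auto
    then show ?thesis
      unfolding a(1) scale_sum .
  qed
  moreover have "\<pi> ^ k *s x \<in> vring_span UNIV b" if x: "x \<in> integral_vectors_on UNIV" for x
  proof -
    have "\<pi> ^ k *s axis l 1 = (\<Sum>i\<in>UNIV. (\<pi> ^ k * d l i) *s b i)" for l
      by (subst d) (simp add: vec.scale_sum_right vector_smult_assoc)
    then have "\<pi> ^ k *s axis l 1 \<in> vring_span UNIV b" for l
      using dk unfolding vring_span_def by (intro CollectI exI[of _ "\<lambda>i. \<pi> ^ k * d l i"]) auto
    then have "(\<Sum>l\<in>UNIV. x $ l *s (\<pi> ^ k *s axis l 1)) \<in> vring_span UNIV b"
      using x unfolding integral_vectors_on_def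
      by (intro vring_submodule_sum[OF vring_submodule_vring_span]) auto
    moreover have "\<pi> ^ k *s x = (\<Sum>l\<in>UNIV. x $ l *s (\<pi> ^ k *s axis l 1))"
      by (subst (1) basis_expansion[symmetric]) (rule scale_sum)
    ultimately show ?thesis by simp
  qed
  ultimately show ?thesis
    unfolding sandwiched_def by blast
qed

lemma sandwiched_has_basis:
  fixes Y :: "('k ^ 'n::finite) set"
  assumes "vring_submodule Y" "sandwiched Y k"
  shows "\<exists>b :: 'n \<Rightarrow> 'k ^ 'n. independent_family UNIV b \<and> Y = vring_span UNIV b"
proof -
  define Y' where "Y' = (*s) (\<pi> ^ k) ` Y"
  have "(*s) (\<pi> ^ (k + k)) ` integral_vectors_on UNIV =
      (*s) (\<pi> ^ k) ` ((*s) (\<pi> ^ k) ` integral_vectors_on UNIV)"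
    unfolding image_image scale_power_add ..
  also have "\<dots> \<subseteq> Y'"
    using assms(2) unfolding sandwiched_def Y'_def by (intro image_mono) simp
  finally have big: "(*s) (\<pi> ^ (k + k)) ` integral_vectors_on UNIV \<subseteq> Y'" .
  have integral: "Y' \<subseteq> integral_vectors_on UNIV"
    using assms(2) unfolding sandwiched_def Y'_def by (rule conjunct1)
  have "vring_submodule Y'"
    unfolding Y'_def by (rule vring_submodule_scale_image[OF assms(1)])
  from vring_submodule_has_basis[OF finite this integral big]
  obtain b :: "'n \<Rightarrow> 'k ^ 'n" where b: "independent_family UNIV b" "Y' = vring_span UNIV b"
    by blast
  have "inverse (\<pi> ^ k) *s (\<pi> ^ k *s x) = x" for x :: "'k ^ 'n"
    using uniformizer_nonzero by (simp add: vector_smult_assoc)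
  then have "Y = (*s) (inverse (\<pi> ^ k)) ` Y'"
    unfolding Y'_def image_image by simp
  then have "Y = vring_span UNIV (\<lambda>i. inverse (\<pi> ^ k) *s b i)"
    unfolding b(2) vring_span_scale .
  moreover have "independent_family UNIV (\<lambda>i. inverse (\<pi> ^ k) *s b i)"
    using b(1) uniformizer_nonzero by (intro independent_family_scale) auto
  ultimately show ?thesis by blast
qed

lemma is_lattice_iff_vring_span:
  "is_lattice v L \<longleftrightarrow> (\<exists>b :: 5 \<Rightarrow> 'k ^ 5. independent_family UNIV b \<and> L = vring_span UNIV b)"
  by (simp add: is_lattice_def independent_family_def vring_span_def)

lemma is_lattice_iff: "is_lattice v L \<longleftrightarrow> vring_submodule L \<and> (\<exists>k. sandwiched L k)"
  unfolding is_lattice_iff_vring_span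
  using sandwiched_vring_span sandwiched_has_basis vring_submodule_vring_span by metis

lemma zero_in_lattice: "is_lattice v L \<Longrightarrow> 0 \<in> L"
  using is_lattice_iff vring_submodule_zero by blast

lemma is_lattice_plus:
  assumes "is_lattice v A" "is_lattice v B"
  shows "is_lattice v (A + B)"
proof -
  obtain ka kb where "sandwiched A ka" "sandwiched B kb"
    using assms is_lattice_iff by blast
  then have A: "sandwiched A (max ka kb)" and B: "sandwiched B (max ka kb)"
    using assms is_lattice_iff sandwiched_mono by (metis max.cobounded1 max.cobounded2)+
  have "\<pi> ^ max ka kb *s x \<in> integral_vectors_on UNIV" if "x \<in> A + B" for x
  proof -
    obtain a b where "a \<in> A" "b \<in> B" "x = a + b"
      using \<open>x \<in> A + B\<close> by (meson set_plus_elim)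
    moreover have "\<pi> ^ max ka kb *s a \<in> integral_vectors_on UNIV" "\<pi> ^ max ka kb *s b \<in> integral_vectors_on UNIV"
      using A B \<open>a \<in> A\<close> \<open>b \<in> B\<close> unfolding sandwiched_def by blast+
    ultimately show ?thesis
      using vring_submodule_add[OF vring_submodule_integral_vectors] by (simp add: vector_add_ldistrib)
  qed
  moreover have "A \<subseteq> A + B"
    using set_zero_plus2[OF zero_in_lattice[OF assms(2)], of A] by (simp add: add.commute)
  ultimately have "sandwiched (A + B) (max ka kb)"
    using A unfolding sandwiched_def by blast
  then show ?thesis
    using assms is_lattice_iff vring_submodule_plus by blast
qed

lemma is_lattice_scale:
  assumes "is_lattice v A" "c \<noteq> 0"
  shows "is_lattice v ((*s) c ` A)"
  using assms independent_family_scale vring_span_scale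
  unfolding is_lattice_iff_vring_span by metis

lemma lattice_scaled_subset:
  assumes "is_lattice v A" "is_lattice v B"
  shows "\<exists>k. (*s) (\<pi> ^ k) ` A \<subseteq> B"
proof -
  obtain ka kb where "sandwiched A ka" "sandwiched B kb"
    using assms is_lattice_iff by blast
  then have "\<pi> ^ (kb + ka) *s x \<in> B" if "x \<in> A" for x
    using that unfolding sandwiched_def scale_power_add by blast
  then show ?thesis by blast
qed

lemma plus_subset_vring_submodule:
  assumes "vring_submodule C" "A \<subseteq> C" "B \<subseteq> C"
  shows "A + B \<subseteq> C"
  using assms vring_submodule_add[OF assms(1)] by (auto elim!: set_plus_elim)

end

section \<open>Duality and vertex lattices\<close>

locale quadratic_lattices = discretely_valued_field v "of_nat p"
  for p :: nat and v :: "'k::field_char_0 \<Rightarrow> int" +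
  fixes e :: 'k
  assumes e_nonzero: "e \<noteq> 0"
begin

abbreviation \<pi> :: 'k where
  "\<pi> \<equiv> of_nat p"

abbreviation dual :: "('k ^ 5) set \<Rightarrow> ('k ^ 5) set" where
  "dual \<equiv> dual_lattice p e v"

lemma p_nonzero: "p \<noteq> 0"
  using uniformizer_nonzero by auto

lemma vring_submodule_dual: "vring_submodule (dual X)"
  unfolding vring_submodule_def
proof (intro conjI ballI)
  show "0 \<in> dual X"
    by (simp add: dual_lattice_def)
next
  fix x y assume "x \<in> dual X" "y \<in> dual X"
  then show "x + y \<in> dual X"
    by (simp add: dual_lattice_def bil_add_left vring_add)
next
  fix c x assume "c \<in> vring v" "x \<in> dual X"
  then show "c *s x \<in> dual X"
    by (simp add: dual_lattice_def bil_scale_left vring_mult)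
qed

lemma dual_plus:
  assumes "0 \<in> A" "0 \<in> B"
  shows "dual (A + B) = dual A \<inter> dual B"
proof
  have "A \<subseteq> A + B" "B \<subseteq> A + B"
    using set_zero_plus2[OF assms(2), of A] set_zero_plus2[OF assms(1), of B]
    by (simp_all add: add.commute)
  then show "dual (A + B) \<subseteq> dual A \<inter> dual B"
    using dual_lattice_antimono by blast
  show "dual A \<inter> dual B \<subseteq> dual (A + B)"
  proof
    fix x assume x: "x \<in> dual A \<inter> dual B"
    have "bil p e x (a + b) \<in> vring v" if "a \<in> A" "b \<in> B" for a b
      using x that by (simp add: dual_lattice_def bil_add_right vring_add)
    then show "x \<in> dual (A + B)"
      unfolding dual_lattice_def by (auto elim!: set_plus_elim)
  qed
qed

lemma eq_if_bil_basis_eq: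
  fixes b :: "5 \<Rightarrow> 'k ^ 5"
  assumes "independent_family UNIV b" "\<And>j. bil p e x (b j) = bil p e y (b j)"
  shows "x = y"
proof (rule bil_nondegenerate[OF e_nonzero p_nonzero])
  fix w
  obtain a where "w = (\<Sum>i\<in>UNIV. a i *s b i)"
    using independent_family_spans[OF assms(1)] by blast
  then show "bil p e x w = bil p e y w"
    by (simp add: bil_sum_right assms(2))
qed

lemma exists_dual_basis:
  fixes b :: "5 \<Rightarrow> 'k ^ 5"
  assumes "independent_family UNIV b"
  obtains g where "\<And>i j. bil p e (g i) (b j) = (if j = i then 1 else 0)"
proof -
  define f where "f x = (\<chi> j. bil p e x (b j))" for x
  have "Vector_Spaces.linear (*s) (*s) f"
    unfolding Vector_Spaces.linear_iff
    by (auto simp: vec.vector_space_axioms f_def vec_eq_iff bil_add_left bil_scale_left)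
  moreover have "inj f"
  proof (rule injI)
    fix x y assume "f x = f y"
    then have "bil p e x (b j) = bil p e y (b j)" for j
      unfolding f_def by (simp add: vec_eq_iff)
    then show "x = y" by (rule eq_if_bil_basis_eq[OF assms])
  qed
  ultimately have "surj f"
    by (rule vec.linear_inj_imp_surj)
  then have fg: "f (inv f (axis i 1)) = axis i 1" for i
    by (simp add: surj_f_inv_f)
  have "bil p e (inv f (axis i 1)) (b j) = (if j = i then 1 else 0)" for i j
    using arg_cong[OF fg[of i], of "\<lambda>w. w $ j"] by (simp add: f_def axis_def)
  then show ?thesis by (rule that)
qed

lemma dual_vring_span:
  fixes b g :: "5 \<Rightarrow> 'k ^ 5"
  assumes "independent_family UNIV b" "\<And>i j. bil p e (g i) (b j) = (if j = i then 1 else 0)"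
  shows "dual (vring_span UNIV b) = vring_span UNIV g"
proof -
  have coeff: "bil p e (\<Sum>i\<in>UNIV. c i *s g i) (b j) = c j" for c j
  proof -
    have "(\<Sum>i\<in>UNIV. c i * (if j = i then 1 else 0)) = (\<Sum>i\<in>UNIV. if j = i then c i else 0)"
      by (rule sum.cong) auto
    then show ?thesis
      by (simp add: bil_sum_left assms(2))
  qed
  show ?thesis
  proof (intro set_eqI iffI)
    fix x assume "x \<in> dual (vring_span UNIV b)"
    then have "\<forall>i. bil p e x (b i) \<in> vring v"
      using basis_in_vring_span[OF finite UNIV_I, of b] unfolding dual_lattice_def by blast
    moreover have "x = (\<Sum>i\<in>UNIV. bil p e x (b i) *s g i)"
      using assms(1) by (rule eq_if_bil_basis_eq) (simp add: coeff)
    ultimately show "x \<in> vring_span UNIV g"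
      unfolding vring_span_def by (intro CollectI exI[of _ "\<lambda>i. bil p e x (b i)"]) simp
  next
    fix x assume "x \<in> vring_span UNIV g"
    then obtain c where c: "x = (\<Sum>i\<in>UNIV. c i *s g i)" "\<forall>i. c i \<in> vring v"
      unfolding vring_span_def by blast
    have "bil p e x y \<in> vring v" if "y \<in> vring_span UNIV b" for y
    proof -
      obtain a where a: "y = (\<Sum>i\<in>UNIV. a i *s b i)" "\<forall>i. a i \<in> vring v"
        using \<open>y \<in> vring_span UNIV b\<close> unfolding vring_span_def by blast
      have "bil p e x y = (\<Sum>i\<in>UNIV. a i * c i)"
        unfolding c(1) a(1) bil_sum_right coeff ..
      then show ?thesis
        using a(2) c(2) by auto
    qed
    then show "x \<in> dual (vring_span UNIV b)"
      unfolding dual_lattice_def by blast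
  qed
qed

lemma is_lattice_dual_lattice_and_dual_dual:
  assumes "is_lattice v L"
  shows "is_lattice v (dual L) \<and> dual (dual L) = L"
proof -
  obtain b :: "5 \<Rightarrow> 'k ^ 5" where b: "independent_family UNIV b" "L = vring_span UNIV b"
    using assms is_lattice_iff_vring_span by blast
  obtain g where g: "\<And>i j. bil p e (g i) (b j) = (if j = i then 1 else 0)"
    using exists_dual_basis[OF b(1)] by blast
  have "independent_family UNIV g"
    unfolding independent_family_def
  proof (intro allI impI ballI)
    fix a i assume "(\<Sum>i\<in>UNIV. a i *s g i) = 0"
    then have "bil p e (\<Sum>i\<in>UNIV. a i *s g i) (b i) = 0" by simp
    then show "a i = 0"
      by (simp add: bil_sum_left g if_distrib sum.delta cong: if_cong)
  qed
  moreover have "dual L = vring_span UNIV g"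
    using dual_vring_span[OF b(1) g] b(2) by simp
  moreover have "bil p e (b i) (g j) = (if j = i then 1 else 0)" for i j
    using g[of j i] bil_commute[of p e "b i" "g j"] by auto
  then have "dual (vring_span UNIV g) = L"
    using dual_vring_span[OF \<open>independent_family UNIV g\<close>, of b] b(2) by simp
  ultimately show ?thesis
    unfolding is_lattice_iff_vring_span by auto
qed

lemma is_lattice_dual: "is_lattice v L \<Longrightarrow> is_lattice v (dual L)"
  using is_lattice_dual_lattice_and_dual_dual by blast

lemma dual_dual: "is_lattice v L \<Longrightarrow> dual (dual L) = L"
  using is_lattice_dual_lattice_and_dual_dual by blast

abbreviation vertex :: "('k ^ 5) set \<Rightarrow> bool" where
  "vertex \<equiv> is_vertex_lattice p e v"

definition adjacent :: "('k ^ 5) set \<Rightarrow> ('k ^ 5) set \<Rightarrow> bool" where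
  "adjacent A B \<longleftrightarrow> vertex A \<and> vertex B \<and> (A \<subseteq> B \<or> B \<subseteq> A)"

lemma symp_adjacent: "symp adjacent"
  unfolding adjacent_def by (auto intro: sympI)

lemma scale_subset_dual_swap: "(*s) c ` A \<subseteq> dual B \<longleftrightarrow> (*s) c ` B \<subseteq> dual A"
proof -
  have "bil p e (c *s x) y \<in> vring v \<longleftrightarrow> bil p e (c *s y) x \<in> vring v" for x y
    by (simp add: bil_scale_left bil_commute[of p e x y])
  then show ?thesis
    unfolding image_subset_iff dual_lattice_def mem_Collect_eq by blast
qed

lemma plus_subset_dual_plus:
  assumes "A \<subseteq> dual A" "B \<subseteq> dual B" "A \<subseteq> dual B" "0 \<in> A" "0 \<in> B"
  shows "A + B \<subseteq> dual (A + B)"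
proof -
  have "B \<subseteq> dual A"
    using assms(3) subset_dual_lattice_swap by blast
  then have "A + B \<subseteq> dual A" "A + B \<subseteq> dual B"
    using assms(1-3) by (simp_all add: plus_subset_vring_submodule vring_submodule_dual)
  then show ?thesis
    unfolding dual_plus[OF assms(4,5)] by blast
qed

lemma zero_in_scaled_dual: "0 \<in> (*s) c ` dual N"
  using vring_submodule_zero[OF vring_submodule_dual] by (rule image_eqI[rotated]) simp

text \<open>The summand p^(k-1) N^\<or> is integral because 2(k - 1) \<ge> k.\<close>
lemma enlargement_integral:
  assumes "is_lattice v N" "N \<subseteq> dual N" "(*s) (\<pi> ^ k) ` dual N \<subseteq> N" "2 \<le> k"
  shows "N + (*s) (\<pi> ^ (k - 1)) ` dual N \<subseteq> dual (N + (*s) (\<pi> ^ (k - 1)) ` dual N)"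
proof (rule plus_subset_dual_plus)
  have "(k - 1) + (k - 1) = (k - 2) + k"
    using assms(4) by simp
  then have "\<pi> ^ (k - 1) * \<pi> ^ (k - 1) = \<pi> ^ (k - 2) * \<pi> ^ k"
    by (metis power_add)
  then have "bil p e (\<pi> ^ (k - 1) *s z) (\<pi> ^ (k - 1) *s z') = \<pi> ^ (k - 2) * bil p e z (\<pi> ^ k *s z')"
    for z z'
    by (simp add: bil_scale_left bil_scale_right mult.assoc[symmetric])
  moreover have "bil p e z (\<pi> ^ k *s z') \<in> vring v" if "z \<in> dual N" "z' \<in> dual N" for z z'
    using that assms(3) unfolding dual_lattice_def by blast
  ultimately show "(*s) (\<pi> ^ (k - 1)) ` dual N \<subseteq> dual ((*s) (\<pi> ^ (k - 1)) ` dual N)"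
    unfolding subset_dual_lattice_iff by auto
  have "bil p e n (\<pi> ^ (k - 1) *s z) \<in> vring v" if "n \<in> N" "z \<in> dual N" for n z
    using that unfolding dual_lattice_def by (simp add: bil_scale_right bil_commute[of p e n] vring_mult)
  then show "N \<subseteq> dual ((*s) (\<pi> ^ (k - 1)) ` dual N)"
    unfolding subset_dual_lattice_iff by blast
qed (use assms zero_in_lattice zero_in_scaled_dual in auto)

lemma scaled_dual_enlargement:
  assumes "is_lattice v N"
  shows "(*s) (\<pi> ^ j) ` dual (N + (*s) (\<pi> ^ j) ` dual N) \<subseteq> N + (*s) (\<pi> ^ j) ` dual N"
proof -
  have "N \<subseteq> N + (*s) (\<pi> ^ j) ` dual N"
    using set_zero_plus2[OF zero_in_scaled_dual] by (simp add: add.commute)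
  then have "(*s) (\<pi> ^ j) ` dual (N + (*s) (\<pi> ^ j) ` dual N) \<subseteq> (*s) (\<pi> ^ j) ` dual N"
    by (intro image_mono dual_lattice_antimono)
  also have "\<dots> \<subseteq> N + (*s) (\<pi> ^ j) ` dual N"
    by (rule set_zero_plus2[OF zero_in_lattice[OF assms]])
  finally show ?thesis .
qed

lemma enlargement_pairing:
  assumes "(*s) (\<pi> ^ k) ` dual N \<subseteq> N" "1 \<le> k"
  shows "(*s) \<pi> ` dual N \<subseteq> dual (N + (*s) (\<pi> ^ (k - 1)) ` dual N)"
proof -
  have "bil p e (\<pi> *s a) (n + \<pi> ^ (k - 1) *s z) \<in> vring v" if "a \<in> dual N" "n \<in> N" "z \<in> dual N"
    for a n z
  proof -
    have "\<pi> * \<pi> ^ (k - 1) = \<pi> ^ k"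
      using assms(2) by (simp flip: power_Suc)
    then have "bil p e (\<pi> *s a) (n + \<pi> ^ (k - 1) *s z) = \<pi> * bil p e a n + bil p e a (\<pi> ^ k *s z)"
      by (simp add: bil_add_right bil_scale_left bil_scale_right algebra_simps)
    moreover have "bil p e a n \<in> vring v" "bil p e a (\<pi> ^ k *s z) \<in> vring v"
      using that assms(1) unfolding dual_lattice_def by blast+
    ultimately show ?thesis
      by (simp add: vring_add vring_mult)
  qed
  then show ?thesis
    unfolding dual_lattice_def by (auto elim!: set_plus_elim)
qed

lemma vertex_plus:
  assumes "vertex A" "is_lattice v N" "N \<subseteq> dual N" "(*s) \<pi> ` A \<subseteq> dual N"
  shows "vertex (A + N)"
proof -
  have A: "is_lattice v A" "(*s) \<pi> ` A \<subseteq> dual A" "dual A \<subseteq> A"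
    using assms(1) unfolding is_vertex_lattice_def by auto
  have "(*s) \<pi> ` N \<subseteq> N"
    using is_lattice_iff assms(2) vring_submodule_scale by blast
  then have "(*s) \<pi> ` N \<subseteq> dual A \<inter> dual N"
    using assms(3,4) scale_subset_dual_swap by blast
  moreover have "(*s) \<pi> ` A \<subseteq> dual A \<inter> dual N"
    using A(2) assms(4) by blast
  ultimately have "(*s) \<pi> ` (A + N) \<subseteq> dual A \<inter> dual N"
    using vring_submodule_add[OF vring_submodule_dual]
    by (auto simp: vector_add_ldistrib image_subset_iff elim!: set_plus_elim)
  moreover have "dual (A + N) = dual A \<inter> dual N"
    using dual_plus zero_in_lattice A(1) assms(2) by blast
  moreover have "A \<subseteq> A + N"
    using set_zero_plus2[OF zero_in_lattice[OF assms(2)], of A] by (simp add: add.commute)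
  ultimately show ?thesis
    using A(1,3) assms(2) is_lattice_plus unfolding is_vertex_lattice_def by auto
qed

lemma vertex_dual_dual_plus:
  assumes "vertex A" "is_lattice v N" "N \<subseteq> dual N" "N \<subseteq> A"
  shows "vertex (dual (dual A + N))" "dual (dual A + N) \<subseteq> A" "dual (dual A + N) \<subseteq> dual N"
proof -
  have A: "is_lattice v A" "(*s) \<pi> ` A \<subseteq> dual A" "dual A \<subseteq> A"
    using assms(1) unfolding is_vertex_lattice_def by auto
  define M where "M = dual A + N"
  have M: "is_lattice v M"
    unfolding M_def using is_lattice_plus is_lattice_dual A(1) assms(2) by blast
  have "dual A \<subseteq> dual (dual A)" "dual A \<subseteq> dual N"
    using A(3) dual_dual[OF A(1)] dual_lattice_antimono[OF assms(4)] by auto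
  then have "M \<subseteq> dual M"
    unfolding M_def using assms(3) plus_subset_dual_plus zero_in_lattice is_lattice_dual A(1) assms(2)
    by blast
  moreover have "dual A \<subseteq> M" "N \<subseteq> M"
    unfolding M_def using set_zero_plus2 zero_in_lattice is_lattice_dual A(1) assms(2)
    by (metis add.commute)+
  ultimately show "dual M \<subseteq> A" "dual M \<subseteq> dual N" "vertex (dual M)"
    using dual_lattice_antimono dual_dual A M is_lattice_dual
    unfolding is_vertex_lattice_def by (auto, blast+)
qed

lemma exists_adjacent_vertex_in_dual:
  assumes "vertex A" "is_lattice v N" "N \<subseteq> dual N" "(*s) \<pi> ` A \<subseteq> dual N"
  obtains A' where "vertex A'" "A' \<subseteq> dual N" "adjacent\<^sup>*\<^sup>* A A'"
proof -
  have "vertex (A + N)"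
    using vertex_plus[OF assms] .
  moreover have "A \<subseteq> A + N" "N \<subseteq> A + N"
    using set_zero_plus2 zero_in_lattice assms(1,2) unfolding is_vertex_lattice_def
    by (metis add.commute)+
  ultimately have "vertex (dual (dual (A + N) + N))" "dual (dual (A + N) + N) \<subseteq> A + N"
    "dual (dual (A + N) + N) \<subseteq> dual N"
    using vertex_dual_dual_plus[OF _ assms(2,3)] by blast+
  moreover have "adjacent\<^sup>*\<^sup>* A (dual (dual (A + N) + N))"
    using \<open>vertex (A + N)\<close> \<open>A \<subseteq> A + N\<close> assms(1) calculation(1,2)
    by (meson adjacent_def converse_rtranclp_into_rtranclp r_into_rtranclp)
  ultimately show ?thesis
    using that by blast
qed

lemma vertices_in_dual_connected:
  assumes "is_lattice v N" "N \<subseteq> dual N" "(*s) (\<pi> ^ k) ` dual N \<subseteq> N"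
    "vertex A" "vertex B" "A \<subseteq> dual N" "B \<subseteq> dual N"
  shows "adjacent\<^sup>*\<^sup>* A B"
  using assms
proof (induction k arbitrary: N A B rule: less_induct)
  case (less k)
  consider "k \<le> 1" | "2 \<le> k" by linarith
  then show ?case
  proof cases
    case 1
    have "\<pi> *s x \<in> N" if "x \<in> dual N" for x
    proof -
      have "\<pi> *s x = \<pi> ^ (1 - k) *s (\<pi> ^ k *s x)"
        using 1 scale_power_add[of "1 - k" k x] by simp
      moreover have "\<pi> ^ k *s x \<in> N"
        using that less.prems(3) by blast
      ultimately show ?thesis
        using less.prems(1) is_lattice_iff vring_submodule_scale vring_power_uniformizer by metis
    qed
    then have "vertex (dual N)"
      using less.prems(1,2) is_lattice_dual dual_dual unfolding is_vertex_lattice_def by auto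
    then have "adjacent A (dual N)" "adjacent (dual N) B"
      using less.prems(4-7) unfolding adjacent_def by blast+
    then show ?thesis
      by (meson r_into_rtranclp rtranclp.rtrancl_into_rtrancl)
  next
    case 2
    define N' where "N' = N + (*s) (\<pi> ^ (k - 1)) ` dual N"
    have "is_lattice v N'"
      unfolding N'_def using less.prems(1) uniformizer_nonzero
      by (simp add: is_lattice_plus is_lattice_scale is_lattice_dual)
    moreover have "N' \<subseteq> dual N'"
      unfolding N'_def using less.prems(1-3) 2 by (rule enlargement_integral)
    moreover have "(*s) (\<pi> ^ (k - 1)) ` dual N' \<subseteq> N'"
      unfolding N'_def using less.prems(1) by (rule scaled_dual_enlargement)
    moreover have "(*s) \<pi> ` A \<subseteq> dual N'" "(*s) \<pi> ` B \<subseteq> dual N'"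
      using enlargement_pairing[OF less.prems(3)] 2 less.prems(6,7) unfolding N'_def by auto
    ultimately obtain A' B' where A': "vertex A'" "A' \<subseteq> dual N'" "adjacent\<^sup>*\<^sup>* A A'"
      and B': "vertex B'" "B' \<subseteq> dual N'" "adjacent\<^sup>*\<^sup>* B B'"
      using exists_adjacent_vertex_in_dual less.prems(4,5) by metis
    have "adjacent\<^sup>*\<^sup>* A' B'"
      using less.IH[of "k - 1"] 2 \<open>is_lattice v N'\<close> \<open>N' \<subseteq> dual N'\<close>
        \<open>(*s) (\<pi> ^ (k - 1)) ` dual N' \<subseteq> N'\<close> A'(1,2) B'(1,2) by simp
    moreover have "adjacent\<^sup>*\<^sup>* B' B"
      using B'(3) sympD[OF symp_rtranclp[OF symp_adjacent]] by blast
    ultimately show ?thesis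
      using A'(3) by (meson rtranclp_trans)
  qed
qed

lemma vertex_lattices_connected:
  assumes "vertex L" "vertex L'"
  shows "adjacent\<^sup>*\<^sup>* L L'"
proof -
  have L: "is_lattice v L" "dual L \<subseteq> L" and "is_lattice v L'"
    using assms unfolding is_vertex_lattice_def by auto
  define S where "S = L + L'"
  have S: "is_lattice v S" "dual (dual S) = S"
    unfolding S_def using is_lattice_plus dual_dual L(1) \<open>is_lattice v L'\<close> by blast+
  have "L \<subseteq> S" "L' \<subseteq> S"
    unfolding S_def using set_zero_plus2 zero_in_lattice L(1) \<open>is_lattice v L'\<close>
    by (metis add.commute)+
  then have "dual S \<subseteq> dual (dual S)"
    using L(2) S(2) dual_lattice_antimono by blast
  moreover obtain k where "(*s) (\<pi> ^ k) ` dual (dual S) \<subseteq> dual S"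
    using lattice_scaled_subset S is_lattice_dual by metis
  ultimately show ?thesis
    using vertices_in_dual_connected[OF is_lattice_dual[OF S(1)]] assms \<open>L \<subseteq> S\<close> \<open>L' \<subseteq> S\<close> S(2)
    by simp
qed

lemma vertex_lattice_path:
  assumes "vertex L" "vertex L'"
  shows "\<exists>(n::nat) (Ls :: nat \<Rightarrow> ('k ^ 5) set).
           Ls 0 = L \<and> Ls n = L' \<and> (\<forall>i\<le>n. vertex (Ls i)) \<and>
           (\<forall>i<n. Ls i \<subseteq> Ls (Suc i) \<or> Ls (Suc i) \<subseteq> Ls i)"
proof -
  from rtranclp_imp_relpowp[OF vertex_lattices_connected[OF assms]]
  obtain n where "(adjacent ^^ n) L L'" ..
  then obtain Ls where Ls: "Ls 0 = L" "Ls n = L'" "\<forall>i<n. adjacent (Ls i) (Ls (Suc i))"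
    unfolding relpowp_fun_conv by blast
  have step: "adjacent (Ls i) (Ls (Suc i))" if "i < n" for i
    using Ls(3) that by blast
  have "vertex (Ls i)" if "i \<le> n" for i
  proof (cases "i = n")
    case True
    then show ?thesis using Ls(2) assms(2) by simp
  next
    case False
    then show ?thesis using step[of i] that unfolding adjacent_def by simp
  qed
  moreover have "Ls i \<subseteq> Ls (Suc i) \<or> Ls (Suc i) \<subseteq> Ls i" if "i < n" for i
    using step[OF that] unfolding adjacent_def by blast
  ultimately show ?thesis
    using Ls(1,2) by (intro exI[of _ n] exI[of _ Ls]) simp
qed

end

theorem mainTheorem7:
  fixes p :: nat and v :: "'k::field_char_0 \<Rightarrow> int" and e :: 'k
    and L L' :: "('k ^ 5) set"
  assumes "prime p" and "odd p"
    and "is_padic_field p v"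
    and "e \<noteq> 0" and "v e = 0" and "\<not> (\<exists>y. y * y = e)"
    and "is_vertex_lattice p e v L" and "is_vertex_lattice p e v L'"
  shows "\<exists>(n::nat) (Ls :: nat \<Rightarrow> ('k ^ 5) set).
           Ls 0 = L \<and> Ls n = L' \<and>
           (\<forall>i\<le>n. is_vertex_lattice p e v (Ls i)) \<and>
           (\<forall>i<n. Ls i \<subseteq> Ls (Suc i) \<or> Ls (Suc i) \<subseteq> Ls i)"
proof -
  interpret quadratic_lattices p v e
  proof
    show "of_nat p \<noteq> (0 :: 'k)"
      using prime_gt_0_nat[OF assms(1)] by simp
  qed (use assms(3,4) in \<open>simp_all add: is_padic_field_def\<close>)
  show ?thesis
    using vertex_lattice_path[OF assms(7,8)] .
qed

end
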